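(* Let $G$ and $\Gamma$ be any groups, let $n\ge1$, and let $G_n=G\wr\mathfrak S_n$. Then there is a bijective correspondence between the set of isomorphism classes of $\Gamma$-equivariant $G$-principal bundles over a $\Gamma$-set of order $n$ and the set $\mathrm{Hom}(\Gamma,G_n)/G_n$ of $G_n$-conjugacy classes of homomorphisms. The correspondence is as follows: given $\pi:P\to Z$ with $|Z|=n$, choose a bijection $t:\{1,\dots,n\}\to Z$ and a section $s:Z\to P$; these give a $G$-bundle isomorphism $\{1,\dots,n\}\times G\cong P$, $(\ell,g)\mapsto s(t(\ell))g$, through which the $\Gamma$-action on $P$ becomes a homomorphism $\theta:\Gamma\to \mathrm{Aut}_G(\{1,\dots,n\}\times G)=G\wr\mathfrak S_n$, and $[P\to Z]$ corresponds to $[\theta]$.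
   Context: A $\Gamma$-equivariant $G$-principal bundle over a (left, discrete) $\Gamma$-set $Z$ is a set $P$ with a free right $G$-action, a map $\pi:P\to Z$ whose fibres are exactly the $G$-orbits (each nonempty), and a left $\Gamma$-action on $P$ commuting with the $G$-action and inducing the given $\Gamma$-action on $Z$. An isomorphism between two such bundles is a bijection of total spaces commuting with both the $\Gamma$- and $G$-actions (it induces an isomorphism of the base $\Gamma$-sets, not required to be an identity). The wreath product is $G\wr\mathfrak S_n=\mathrm{Map}(\{1,\dots,n\},G)\rtimes\mathfrak S_n$ with $(\sigma f)(k)=f(\sigma^{-1}(k))$ and $(f_1,\sigma_1)(f_2,\sigma_2)=(f_1\cdot\sigma_1f_2,\sigma_1\sigma_2)$. It is identified with the group $\mathrm{Aut}_G(\{1,\dots,n\}\times G)$ of all bijections of $\{1,\dots,n\}\times G$ commuting with right multiplication by $G$, via $(f,\sigma)\cdot(\ell,g)=(\sigma(\ell),f(\sigma(\ell))g)$. *)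

theory Defs
  imports "HOL-Algebra.Algebra"
begin

section \<open>Wreath products\<close>

definition wreath_perm :: "nat \<Rightarrow> (nat \<Rightarrow> nat) \<Rightarrow> (nat \<Rightarrow> 'g) \<Rightarrow> nat \<Rightarrow> 'g" where
  "wreath_perm n \<sigma> f = (\<lambda>k\<in>{1..n}. f ((inv\<^bsub>sym_group n\<^esub> \<sigma>) k))"

definition wreath :: "('g, 'm) monoid_scheme \<Rightarrow> nat \<Rightarrow> ((nat \<Rightarrow> 'g) \<times> (nat \<Rightarrow> nat)) monoid" where
  "wreath G n =
     \<lparr>carrier = carrier (product_group {1..n} (\<lambda>_. G)) \<times> carrier (sym_group n),
      monoid.mult = (\<lambda>(f1, \<sigma>1) (f2, \<sigma>2).
        (f1 \<otimes>\<^bsub>product_group {1..n} (\<lambda>_. G)\<^esub> wreath_perm n \<sigma>1 f2, \<sigma>1 \<otimes>\<^bsub>sym_group n\<^esub> \<sigma>2)),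
      one = (\<one>\<^bsub>product_group {1..n} (\<lambda>_. G)\<^esub>, \<one>\<^bsub>sym_group n\<^esub>)\<rparr>"

definition std_total :: "('g, 'm) monoid_scheme \<Rightarrow> nat \<Rightarrow> (nat \<times> 'g) set" where
  "std_total G n = {1..n} \<times> carrier G"

definition std_ract :: "('g, 'm) monoid_scheme \<Rightarrow> nat \<times> 'g \<Rightarrow> 'g \<Rightarrow> nat \<times> 'g" where
  "std_ract G x k = (fst x, snd x \<otimes>\<^bsub>G\<^esub> k)"

definition Aut_std :: "('g, 'm) monoid_scheme \<Rightarrow> nat \<Rightarrow> (nat \<times> 'g \<Rightarrow> nat \<times> 'g) monoid" where
  "Aut_std G n = BijGroup (std_total G n)
     \<lparr>carrier := {h \<in> Bij (std_total G n).
        \<forall>x\<in>std_total G n. \<forall>k\<in>carrier G. h (std_ract G x k) = std_ract G (h x) k}\<rparr>"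

definition wreath_to_Aut ::
  "('g, 'm) monoid_scheme \<Rightarrow> nat \<Rightarrow> (nat \<Rightarrow> 'g) \<times> (nat \<Rightarrow> nat) \<Rightarrow> nat \<times> 'g \<Rightarrow> nat \<times> 'g" where
  "wreath_to_Aut G n = (\<lambda>(f, \<sigma>). \<lambda>(l, g)\<in>std_total G n. (\<sigma> l, f (\<sigma> l) \<otimes>\<^bsub>G\<^esub> g))"


section \<open>Conjugacy classes of homomorphisms\<close>

text \<open>Homomorphisms are normalised outside the carrier of the source, so that equality of
  functions is equality of homomorphisms.\<close>

definition Homs :: "('c, 'k) monoid_scheme \<Rightarrow> ('h, 'm) monoid_scheme \<Rightarrow> ('c \<Rightarrow> 'h) set" where
  "Homs \<Gamma> H = hom \<Gamma> H \<inter> extensional (carrier \<Gamma>)"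

definition conj_rel ::
  "('c, 'k) monoid_scheme \<Rightarrow> ('h, 'm) monoid_scheme \<Rightarrow> (('c \<Rightarrow> 'h) \<times> ('c \<Rightarrow> 'h)) set" where
  "conj_rel \<Gamma> H = {(\<theta>, \<theta>'). \<theta> \<in> Homs \<Gamma> H \<and> \<theta>' \<in> Homs \<Gamma> H \<and>
     (\<exists>w\<in>carrier H. \<forall>\<gamma>\<in>carrier \<Gamma>. \<theta>' \<gamma> = w \<otimes>\<^bsub>H\<^esub> \<theta> \<gamma> \<otimes>\<^bsub>H\<^esub> inv\<^bsub>H\<^esub> w)}"


section \<open>Equivariant principal bundles over discrete sets\<close>

text \<open>The fields \<open>ract\<close>, \<open>tact\<close> and \<open>bact\<close> are the right action of the structure group on the total
  space and the left actions of the equivariance group on the total space and on the base. The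
  left actions use \<^const>\<open>group_action\<close>, whose maps are normalised outside the set acted upon;
  \<open>ract\<close> and \<open>proj\<close> are arbitrary outside it. Isomorphism ignores all such values.\<close>

record ('g, 'c, 'p, 'z) gbundle =
  tot_space :: "'p set"
  base :: "'z set"
  proj :: "'p \<Rightarrow> 'z"
  ract :: "'p \<Rightarrow> 'g \<Rightarrow> 'p"
  tact :: "'c \<Rightarrow> 'p \<Rightarrow> 'p"
  bact :: "'c \<Rightarrow> 'z \<Rightarrow> 'z"

definition free_right_action :: "('g, 'm) monoid_scheme \<Rightarrow> 'p set \<Rightarrow> ('p \<Rightarrow> 'g \<Rightarrow> 'p) \<Rightarrow> bool" where
  "free_right_action G P r \<longleftrightarrow>
     (\<forall>p\<in>P. \<forall>g\<in>carrier G. r p g \<in> P) \<and>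
     (\<forall>p\<in>P. r p \<one>\<^bsub>G\<^esub> = p) \<and>
     (\<forall>p\<in>P. \<forall>g\<in>carrier G. \<forall>h\<in>carrier G. r p (g \<otimes>\<^bsub>G\<^esub> h) = r (r p g) h) \<and>
     (\<forall>p\<in>P. \<forall>g\<in>carrier G. r p g = p \<longrightarrow> g = \<one>\<^bsub>G\<^esub>)"

definition equivariant_bundle ::
  "('g, 'm) monoid_scheme \<Rightarrow> ('c, 'k) monoid_scheme \<Rightarrow> ('g, 'c, 'p, 'z) gbundle \<Rightarrow> bool" where
  "equivariant_bundle G \<Gamma> B \<longleftrightarrow>
     free_right_action G (tot_space B) (ract B) \<and>
     group_action \<Gamma> (tot_space B) (tact B) \<and>
     group_action \<Gamma> (base B) (bact B) \<and>
     proj B \<in> tot_space B \<rightarrow> base B \<and>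
     (\<forall>z\<in>base B. \<exists>p\<in>tot_space B. {q \<in> tot_space B. proj B q = z} = ract B p ` carrier G) \<and>
     (\<forall>\<gamma>\<in>carrier \<Gamma>. \<forall>p\<in>tot_space B. \<forall>g\<in>carrier G.
        tact B \<gamma> (ract B p g) = ract B (tact B \<gamma> p) g) \<and>
     (\<forall>\<gamma>\<in>carrier \<Gamma>. \<forall>p\<in>tot_space B. proj B (tact B \<gamma> p) = bact B \<gamma> (proj B p))"

definition bundle_iso ::
  "('g, 'm) monoid_scheme \<Rightarrow> ('c, 'k) monoid_scheme \<Rightarrow>
   ('g, 'c, 'p, 'z) gbundle \<Rightarrow> ('g, 'c, 'q, 'w) gbundle \<Rightarrow> bool" where
  "bundle_iso G \<Gamma> B B' \<longleftrightarrow>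
     (\<exists>F. bij_betw F (tot_space B) (tot_space B') \<and>
       (\<forall>p\<in>tot_space B. \<forall>g\<in>carrier G. F (ract B p g) = ract B' (F p) g) \<and>
       (\<forall>\<gamma>\<in>carrier \<Gamma>. \<forall>p\<in>tot_space B. F (tact B \<gamma> p) = tact B' \<gamma> (F p)))"

definition bundle_of_order ::
  "('g, 'm) monoid_scheme \<Rightarrow> ('c, 'k) monoid_scheme \<Rightarrow> nat \<Rightarrow> ('g, 'c, 'p, 'z) gbundle \<Rightarrow> bool" where
  "bundle_of_order G \<Gamma> n B \<longleftrightarrow>
     equivariant_bundle G \<Gamma> B \<and> finite (base B) \<and> card (base B) = n"

text \<open>The collection of all bundles is a proper class, so isomorphism classes are formed among the
  bundles with total space in the type \<^typ>\<open>nat \<times> 'g\<close> and base in \<^typ>\<open>nat\<close>. These types are large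
  enough: \<open>bundle_class\<close> sends a bundle over arbitrary types to the set of its isomorphic copies
  among these, and the main theorem asserts that this set is again an isomorphism class (in
  particular nonempty). For a bundle already living in these types it is its isomorphism class.\<close>

type_synonym ('g, 'c) std_bundle = "('g, 'c, nat \<times> 'g, nat) gbundle"

definition bundle_iso_rel ::
  "('g, 'm) monoid_scheme \<Rightarrow> ('c, 'k) monoid_scheme \<Rightarrow> nat \<Rightarrow>
   (('g, 'c) std_bundle \<times> ('g, 'c) std_bundle) set" where
  "bundle_iso_rel G \<Gamma> n =
     {(B, B'). bundle_of_order G \<Gamma> n B \<and> bundle_of_order G \<Gamma> n B' \<and> bundle_iso G \<Gamma> B B'}"

definition bundle_class ::
  "('g, 'm) monoid_scheme \<Rightarrow> ('c, 'k) monoid_scheme \<Rightarrow> nat \<Rightarrow>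
   ('g, 'c, 'p, 'z) gbundle \<Rightarrow> ('g, 'c) std_bundle set" where
  "bundle_class G \<Gamma> n B = {B'. bundle_of_order G \<Gamma> n B' \<and> bundle_iso G \<Gamma> B B'}"

definition bundle_classes ::
  "('g, 'm) monoid_scheme \<Rightarrow> ('c, 'k) monoid_scheme \<Rightarrow> nat \<Rightarrow> ('g, 'c) std_bundle set set" where
  "bundle_classes G \<Gamma> n = {B. bundle_of_order G \<Gamma> n B} // bundle_iso_rel G \<Gamma> n"


section \<open>From bundles to homomorphisms\<close>

definition framing :: "nat \<Rightarrow> ('g, 'c, 'p, 'z) gbundle \<Rightarrow> (nat \<Rightarrow> 'z) \<Rightarrow> ('z \<Rightarrow> 'p) \<Rightarrow> bool" where
  "framing n B t s \<longleftrightarrow>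
     bij_betw t {1..n} (base B) \<and> s \<in> base B \<rightarrow> tot_space B \<and> (\<forall>z\<in>base B. proj B (s z) = z)"

definition trivialization ::
  "('g, 'c, 'p, 'z) gbundle \<Rightarrow> (nat \<Rightarrow> 'z) \<Rightarrow> ('z \<Rightarrow> 'p) \<Rightarrow> nat \<times> 'g \<Rightarrow> 'p" where
  "trivialization B t s = (\<lambda>(l, g). ract B (s (t l)) g)"

definition transported_action ::
  "('g, 'm) monoid_scheme \<Rightarrow> nat \<Rightarrow> ('g, 'c, 'p, 'z) gbundle \<Rightarrow> (nat \<Rightarrow> 'z) \<Rightarrow> ('z \<Rightarrow> 'p) \<Rightarrow>
   'c \<Rightarrow> nat \<times> 'g \<Rightarrow> nat \<times> 'g" where
  "transported_action G n B t s \<gamma> =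
     (\<lambda>x\<in>std_total G n.
        inv_into (std_total G n) (trivialization B t s) (tact B \<gamma> (trivialization B t s x)))"

definition bundle_hom ::
  "('g, 'm) monoid_scheme \<Rightarrow> ('c, 'k) monoid_scheme \<Rightarrow> nat \<Rightarrow> ('g, 'c, 'p, 'z) gbundle \<Rightarrow>
   (nat \<Rightarrow> 'z) \<Rightarrow> ('z \<Rightarrow> 'p) \<Rightarrow> 'c \<Rightarrow> (nat \<Rightarrow> 'g) \<times> (nat \<Rightarrow> nat)" where
  "bundle_hom G \<Gamma> n B t s =
     (\<lambda>\<gamma>\<in>carrier \<Gamma>.
        inv_into (carrier (wreath G n)) (wreath_to_Aut G n) (transported_action G n B t s \<gamma>))"

text \<open>The union over all representatives and all framings; that it is a single conjugacy class,
  independent of these choices, is part of the main theorem.\<close>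

definition bundle_correspondence ::
  "('g, 'm) monoid_scheme \<Rightarrow> ('c, 'k) monoid_scheme \<Rightarrow> nat \<Rightarrow>
   ('g, 'c) std_bundle set \<Rightarrow> ('c \<Rightarrow> (nat \<Rightarrow> 'g) \<times> (nat \<Rightarrow> nat)) set" where
  "bundle_correspondence G \<Gamma> n C =
     \<Union> {conj_rel \<Gamma> (wreath G n) `` {bundle_hom G \<Gamma> n B t s} | B t s. B \<in> C \<and> framing n B t s}"

end

theory Submission
  imports Defs
begin

text \<open>
  A homomorphism \<open>\<theta>\<close> from \<open>\<Gamma>\<close> to the wreath product lets \<open>\<Gamma>\<close> act on \<open>{1..n} \<times> G\<close> by automorphisms of the
  trivial \<open>G\<close>-bundle, and so makes the trivial bundle an equivariant one, the model bundle of \<open>\<theta>\<close>.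
  The theorem says that every equivariant bundle of order \<open>n\<close> is isomorphic to a model bundle, and
  that model bundles are isomorphic precisely when their homomorphisms are conjugate.

  The second claim (\<open>model_iso_iff_conj\<close>) is the heart of the matter and is nearly a tautology once
  the wreath product is identified with the automorphism group of the trivial bundle
  (\<open>wreath_to_Aut_iso\<close>): a \<open>G\<close>-equivariant bijection of the trivial bundle with itself is
  an element \<open>w\<close> of the wreath product, and it is \<open>\<Gamma>\<close>-equivariant from the model of \<open>\<theta>\<close> to that of
  \<open>\<theta>'\<close> if and only if \<open>w \<cdot> \<theta> \<gamma> = \<theta>' \<gamma> \<cdot> w\<close> for all \<open>\<gamma>\<close>.

  For the first claim, the trivialization defined by a framing \<open>(t, s)\<close> of a bundle \<open>B\<close> is
  \<open>G\<close>-equivariant and bijective, and \<open>bundle_hom\<close> is defined by transporting the action along it.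
  Hence the trivialization is an isomorphism onto \<open>B\<close> from the model of its \<open>bundle_hom\<close>
  (\<open>model_bundle_hom_iso\<close>).

  Everything else is formal. Replacing two framed bundles by their models shows that they are
  isomorphic if and only if their homomorphisms are conjugate (\<open>bundle_iso_iff_conj\<close>). This one
  equivalence gives independence of the framing and of the representative, and injectivity.
  Surjectivity follows because any framing of the model of \<open>\<theta>\<close> produces a homomorphism whose model
  is isomorphic to that of \<open>\<theta>\<close>, hence one that is conjugate to \<open>\<theta>\<close>.
\<close>

(* Keeps the interval {1..n} in one form: the simplifier would otherwise turn it into {Suc 0..n}. *)
declare One_nat_def [simp del]

section \<open>Automorphisms of the trivial bundle\<close>

lemma mem_std_total [simp]: "(l, g) \<in> std_total G n \<longleftrightarrow> l \<in> {1..n} \<and> g \<in> carrier G"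
  by (simp add: std_total_def)

lemma std_ract_Pair [simp]: "std_ract G (l, g) k = (l, g \<otimes>\<^bsub>G\<^esub> k)"
  by (simp add: std_ract_def)

lemma (in group) std_ract_closed:
  "x \<in> std_total G n \<Longrightarrow> k \<in> carrier G \<Longrightarrow> std_ract G x k \<in> std_total G n"
  by (cases x) simp

lemma mem_Aut_std:
  "h \<in> carrier (Aut_std G n) \<longleftrightarrow>
     h \<in> extensional (std_total G n) \<and> bij_betw h (std_total G n) (std_total G n) \<and>
     (\<forall>x\<in>std_total G n. \<forall>k\<in>carrier G. h (std_ract G x k) = std_ract G (h x) k)"
  by (auto simp: Aut_std_def Bij_def)

lemma mult_Aut_std:
  assumes "h \<in> carrier (Aut_std G n)" "k \<in> carrier (Aut_std G n)"
  shows "h \<otimes>\<^bsub>Aut_std G n\<^esub> k = compose (std_total G n) h k"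
  using assms by (simp add: Aut_std_def BijGroup_def)

lemma Aut_std_closed:
  assumes "h \<in> carrier (Aut_std G n)" "x \<in> std_total G n"
  shows "h x \<in> std_total G n"
  using assms by (auto simp: mem_Aut_std dest: bij_betwE)

lemma Aut_std_eqI:
  assumes "h \<in> carrier (Aut_std G n)" "k \<in> carrier (Aut_std G n)"
    and "\<And>x. x \<in> std_total G n \<Longrightarrow> h x = k x"
  shows "h = k"
  using assms by (auto simp: mem_Aut_std intro: extensionalityI)

text \<open>The \<open>G\<close>-equivariant bijections form a subgroup of all bijections because the inverse of an
  equivariant bijection is again equivariant.\<close>

lemma (in group) group_Aut_std: "group (Aut_std G n)"
proof -
  let ?S = "std_total G n"
  let ?A = "{h \<in> Bij ?S. \<forall>x\<in>?S. \<forall>k\<in>carrier G. h (std_ract G x k) = std_ract G (h x) k}"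
  have "subgroup ?A (BijGroup ?S)"
  proof (rule group.subgroupI[OF group_BijGroup])
    show "?A \<subseteq> carrier (BijGroup ?S)" by (auto simp: BijGroup_def)
    have "(\<lambda>x\<in>?S. x) \<in> ?A" using id_Bij[of ?S] by (auto simp: std_ract_closed)
    then show "?A \<noteq> {}" by blast
  next
    fix h assume h: "h \<in> ?A"
    then have bij: "bij_betw h ?S ?S" by (simp add: Bij_def)
    let ?i = "inv_into ?S h"
    have "?i (std_ract G y k) = std_ract G (?i y) k" if y: "y \<in> ?S" and k: "k \<in> carrier G" for y k
    proof -
      have iy: "?i y \<in> ?S" "h (?i y) = y"
        using bij y by (auto simp: bij_betw_inv_into_right intro: bij_betwE[OF bij_betw_inv_into, rule_format])
      then have "std_ract G y k = h (std_ract G (?i y) k)" using h k by auto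
      then show ?thesis using bij iy k by (simp add: bij_betw_inv_into_left std_ract_closed)
    qed
    moreover have "inv\<^bsub>BijGroup ?S\<^esub> h = restrict ?i ?S" using h by (simp add: inv_BijGroup)
    ultimately show "inv\<^bsub>BijGroup ?S\<^esub> h \<in> ?A"
      using h by (simp add: restrict_inv_into_Bij std_ract_closed)
  next
    fix h k assume "h \<in> ?A" "k \<in> ?A"
    then show "h \<otimes>\<^bsub>BijGroup ?S\<^esub> k \<in> ?A"
      by (auto simp: BijGroup_def compose_Bij compose_eq std_ract_closed
          dest: funcset_mem[OF Bij_imp_funcset])
  qed
  then show ?thesis
    unfolding Aut_std_def using group_BijGroup by (rule subgroup.subgroup_is_group)
qed


section \<open>The wreath product as an automorphism group\<close>

lemma mem_wreath:
  "(f, \<sigma>) \<in> carrier (wreath G n) \<longleftrightarrow> f \<in> {1..n} \<rightarrow>\<^sub>E carrier G \<and> \<sigma> permutes {1..n}"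
  by (simp add: wreath_def sym_group_def)

lemma mult_wreath:
  assumes "\<sigma> permutes {1..n}"
  shows "(f, \<sigma>) \<otimes>\<^bsub>wreath G n\<^esub> (f', \<sigma>') =
    ((\<lambda>k\<in>{1..n}. f k \<otimes>\<^bsub>G\<^esub> f' (Hilbert_Choice.inv \<sigma> k)), \<sigma> \<circ> \<sigma>')"
  using assms
  by (simp add: wreath_def wreath_perm_def sym_group_carrier sym_group_mult restrict_def fun_eq_iff)

lemma wreath_to_Aut_apply:
  "l \<in> {1..n} \<Longrightarrow> g \<in> carrier G \<Longrightarrow>
    wreath_to_Aut G n (f, \<sigma>) (l, g) = (\<sigma> l, f (\<sigma> l) \<otimes>\<^bsub>G\<^esub> g)"
  by (simp add: wreath_to_Aut_def)

lemma (in group) wreath_mult_closed: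
  assumes "u \<in> carrier (wreath G n)" "v \<in> carrier (wreath G n)"
  shows "u \<otimes>\<^bsub>wreath G n\<^esub> v \<in> carrier (wreath G n)"
proof -
  obtain f \<sigma> f' \<sigma>' where uv: "u = (f, \<sigma>)" "v = (f', \<sigma>')" by fastforce
  with assms have *: "f \<in> {1..n} \<rightarrow>\<^sub>E carrier G" "\<sigma> permutes {1..n}"
    "f' \<in> {1..n} \<rightarrow>\<^sub>E carrier G" "\<sigma>' permutes {1..n}"
    by (simp_all add: mem_wreath)
  have "Hilbert_Choice.inv \<sigma> k \<in> {1..n}" if "k \<in> {1..n}" for k
    using permutes_in_image[OF permutes_inv[OF *(2)]] that by blast
  with * show ?thesis
    by (auto simp: uv mult_wreath mem_wreath permutes_compose PiE_mem simp del: atLeastAtMost_iff)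
qed

lemma (in group) wreath_to_Aut_closed:
  assumes "w \<in> carrier (wreath G n)"
  shows "wreath_to_Aut G n w \<in> carrier (Aut_std G n)"
proof -
  obtain f \<sigma> where w: "w = (f, \<sigma>)" by (cases w)
  let ?S = "std_total G n" and ?h = "wreath_to_Aut G n (f, \<sigma>)"
  have f: "f k \<in> carrier G" if "k \<in> {1..n}" for k
    using assms that by (auto simp: w mem_wreath)
  have \<sigma>: "\<sigma> permutes {1..n}" using assms by (simp add: w mem_wreath)
  have \<sigma>_in: "\<sigma> l \<in> {1..n}" if "l \<in> {1..n}" for l using permutes_in_image[OF \<sigma>] that by blast
  have inv_in: "Hilbert_Choice.inv \<sigma> l \<in> {1..n}" if "l \<in> {1..n}" for l
    using permutes_in_image[OF permutes_inv[OF \<sigma>]] that by blast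
  \<comment> \<open>The inverse of \<open>(l, g) \<mapsto> (\<sigma> l, f (\<sigma> l) \<cdot> g)\<close>, found by solving for \<open>l\<close> and \<open>g\<close>.\<close>
  have "bij_betw ?h ?S ?S"
  proof (rule bij_betw_byWitness[where f' =
        "\<lambda>(k, g). (Hilbert_Choice.inv \<sigma> k, inv (f k) \<otimes> g)"])
    show "\<forall>x\<in>?S. (case ?h x of (k, g) \<Rightarrow> (Hilbert_Choice.inv \<sigma> k, inv (f k) \<otimes> g)) = x"
      using f \<sigma>_in by (auto simp: wreath_to_Aut_apply permutes_inverses[OF \<sigma>] inv_solve_left' m_assoc[symmetric]
          simp del: atLeastAtMost_iff)
    show "\<forall>y\<in>?S. ?h (case y of (k, g) \<Rightarrow> (Hilbert_Choice.inv \<sigma> k, inv (f k) \<otimes> g)) = y"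
      using f inv_in by (auto simp: wreath_to_Aut_apply permutes_inverses[OF \<sigma>] m_assoc[symmetric]
          simp del: atLeastAtMost_iff)
    show "?h ` ?S \<subseteq> ?S"
      using f \<sigma>_in by (auto simp: wreath_to_Aut_apply simp del: atLeastAtMost_iff)
    show "(\<lambda>(k, g). (Hilbert_Choice.inv \<sigma> k, inv (f k) \<otimes> g)) ` ?S \<subseteq> ?S"
      using f inv_in by (auto simp del: atLeastAtMost_iff)
  qed
  moreover have "?h (std_ract G x k) = std_ract G (?h x) k" if "x \<in> ?S" "k \<in> carrier G" for x k
    using that f \<sigma>_in by (cases x) (simp add: wreath_to_Aut_apply m_assoc del: atLeastAtMost_iff)
  moreover have "?h \<in> extensional ?S"
    by (simp add: wreath_to_Aut_def)
  ultimately show ?thesis by (simp add: w mem_Aut_std)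
qed

text \<open>The twist in the multiplication of the wreath product is exactly what composition requires: both
  sides send \<open>(l, g)\<close> to \<open>(\<sigma> (\<sigma>' l), f (\<sigma> (\<sigma>' l)) \<cdot> f' (\<sigma>' l) \<cdot> g)\<close>.\<close>

lemma (in group) wreath_to_Aut_mult:
  assumes "u \<in> carrier (wreath G n)" "v \<in> carrier (wreath G n)"
  shows "wreath_to_Aut G n (u \<otimes>\<^bsub>wreath G n\<^esub> v) =
    wreath_to_Aut G n u \<otimes>\<^bsub>Aut_std G n\<^esub> wreath_to_Aut G n v"
proof -
  obtain f \<sigma> f' \<sigma>' where uv: "u = (f, \<sigma>)" "v = (f', \<sigma>')" by fastforce
  with assms have f: "f k \<in> carrier G" "f' k \<in> carrier G" if "k \<in> {1..n}" for k
    using that by (auto simp: mem_wreath)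
  have \<sigma>: "\<sigma> permutes {1..n}" "\<sigma>' permutes {1..n}"
    using assms by (auto simp: uv mem_wreath)
  have \<sigma>_in: "\<sigma> l \<in> {1..n}" "\<sigma>' l \<in> {1..n}" if "l \<in> {1..n}" for l
    using permutes_in_image[OF \<sigma>(1)] permutes_in_image[OF \<sigma>(2)] that by blast+
  have "wreath_to_Aut G n (u \<otimes>\<^bsub>wreath G n\<^esub> v) (l, g) =
      wreath_to_Aut G n u (wreath_to_Aut G n v (l, g))" if "l \<in> {1..n}" "g \<in> carrier G" for l g
    using that f \<sigma>_in
    by (simp add: uv mult_wreath \<sigma> wreath_to_Aut_apply permutes_inverses[OF \<sigma>(1)] m_assoc
        del: atLeastAtMost_iff)
  then have "wreath_to_Aut G n (u \<otimes>\<^bsub>wreath G n\<^esub> v) =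
      compose (std_total G n) (wreath_to_Aut G n u) (wreath_to_Aut G n v)"
    using wreath_to_Aut_closed[OF wreath_mult_closed[OF assms]]
    by (intro extensionalityI[where A = "std_total G n"]) (auto simp: mem_Aut_std compose_eq)
  then show ?thesis using assms by (simp add: mult_Aut_std wreath_to_Aut_closed)
qed

text \<open>The values at the points \<open>(l, \<one>)\<close> determine \<open>\<sigma>\<close>, and then \<open>f\<close> because \<open>\<sigma>\<close> is onto.\<close>

lemma (in group) wreath_to_Aut_inj: "inj_on (wreath_to_Aut G n) (carrier (wreath G n))"
proof (rule inj_onI)
  fix u v assume uv_in: "u \<in> carrier (wreath G n)" "v \<in> carrier (wreath G n)"
    and eq: "wreath_to_Aut G n u = wreath_to_Aut G n v"
  obtain f \<sigma> f' \<sigma>' where uv: "u = (f, \<sigma>)" "v = (f', \<sigma>')" by fastforce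
  have f: "f \<in> {1..n} \<rightarrow>\<^sub>E carrier G" "f' \<in> {1..n} \<rightarrow>\<^sub>E carrier G"
    and \<sigma>: "\<sigma> permutes {1..n}" "\<sigma>' permutes {1..n}"
    using uv_in by (auto simp: uv mem_wreath)
  have pair: "(\<sigma> l, f (\<sigma> l) \<otimes> \<one>) = (\<sigma>' l, f' (\<sigma>' l) \<otimes> \<one>)" if "l \<in> {1..n}" for l
    using fun_cong[OF eq[unfolded uv], of "(l, \<one>)"]
    by (simp only: wreath_to_Aut_apply[OF that one_closed])
  have perm_eq: "\<sigma> l = \<sigma>' l" if "l \<in> {1..n}" for l
    by (rule Pair_inject[OF pair[OF that]])
  have "\<sigma> = \<sigma>'"
  proof
    fix l show "\<sigma> l = \<sigma>' l"
    proof (cases "l \<in> {1..n}")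
      case True then show ?thesis by (rule perm_eq)
    next
      case False
      have "\<sigma> l = l" "\<sigma>' l = l" using permutes_not_in[OF _ False] \<sigma> by blast+
      then show ?thesis by simp
    qed
  qed
  moreover have "f k = f' k" if k: "k \<in> {1..n}" for k
  proof -
    obtain l where l: "l \<in> {1..n}" "k = \<sigma> l" using permutes_image[OF \<sigma>(1)] k by blast
    have "f (\<sigma> l) \<otimes> \<one> = f' (\<sigma>' l) \<otimes> \<one>" by (rule Pair_inject[OF pair[OF l(1)]])
    then have "f k \<otimes> \<one> = f' k \<otimes> \<one>" unfolding l(2) perm_eq[OF l(1)] .
    then show ?thesis using PiE_mem[OF f(1) k] PiE_mem[OF f(2) k] by simp
  qed
  then have "f = f'" using f by (intro PiE_ext)
  ultimately show "u = v" by (simp add: uv)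
qed

text \<open>By equivariance an automorphism \<open>h\<close> is determined by \<open>h (l, \<one>) = (c l, d l)\<close>. The map \<open>c\<close> on
  indices is injective because \<open>(l, inv (d l))\<close> is the point sent by \<open>h\<close> to \<open>(c l, \<one>)\<close>, so it is a
  permutation by finiteness; \<open>d\<close> reindexed along it is the function component.\<close>

lemma (in group) wreath_to_Aut_surj:
  assumes h: "h \<in> carrier (Aut_std G n)"
  shows "h \<in> wreath_to_Aut G n ` carrier (wreath G n)"
proof -
  let ?S = "std_total G n"
  have bij: "bij_betw h ?S ?S" using h by (simp add: mem_Aut_std)
  define c where "c l = fst (h (l, \<one>))" for l
  define d where "d l = snd (h (l, \<one>))" for l
  have cd: "c l \<in> {1..n}" "d l \<in> carrier G" if "l \<in> {1..n}" for l
    using Aut_std_closed[OF h, of "(l, \<one>)"] that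
    unfolding c_def d_def by (cases "h (l, \<one>)"; simp)+
  have h_eq: "h (l, g) = (c l, d l \<otimes> g)" if "l \<in> {1..n}" "g \<in> carrier G" for l g
  proof -
    have "h (l, g) = h (std_ract G (l, \<one>) g)" using that by simp
    also have "\<dots> = std_ract G (h (l, \<one>)) g" using h that by (auto simp: mem_Aut_std simp del: std_ract_Pair)
    finally show ?thesis by (simp add: std_ract_def c_def d_def)
  qed
  have "inj_on c {1..n}"
  proof (rule inj_onI)
    fix l l' assume l: "l \<in> {1..n}" "l' \<in> {1..n}" and c: "c l = c l'"
    have "h (l, inv (d l)) = h (l', inv (d l'))" using l c cd by (simp add: h_eq del: atLeastAtMost_iff)
    moreover have "(l, inv (d l)) \<in> ?S" "(l', inv (d l')) \<in> ?S"
      using l cd by (simp_all del: atLeastAtMost_iff)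
    ultimately have "(l, inv (d l)) = (l', inv (d l'))"
      using bij by (auto simp: bij_betw_def simp del: Pair_inject mem_std_total dest: inj_onD)
    then show "l = l'" by simp
  qed
  then have "bij_betw c {1..n} {1..n}"
    using cd(1) endo_inj_surj[of "{1..n}" c] by (auto simp: bij_betw_def simp del: atLeastAtMost_iff)
  \<comment> \<open>Permutations are the identity outside \<open>{1..n}\<close>, where \<open>c\<close> is uncontrolled.\<close>
  define \<sigma> where "\<sigma> = (\<lambda>l. if l \<in> {1..n} then c l else l)"
  have \<sigma>: "\<sigma> permutes {1..n}"
  proof (rule bij_imp_permutes)
    show "bij_betw \<sigma> {1..n} {1..n}"
      using \<open>bij_betw c {1..n} {1..n}\<close> by (simp add: \<sigma>_def cong: bij_betw_cong del: atLeastAtMost_iff)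
  qed (auto simp: \<sigma>_def)
  have inv_in: "Hilbert_Choice.inv \<sigma> l \<in> {1..n}" if "l \<in> {1..n}" for l
    using permutes_in_image[OF permutes_inv[OF \<sigma>]] that by blast
  define f where "f = (\<lambda>k\<in>{1..n}. d (Hilbert_Choice.inv \<sigma> k))"
  have w: "(f, \<sigma>) \<in> carrier (wreath G n)"
    using \<sigma> inv_in cd by (auto simp: mem_wreath f_def)
  have f_eq: "f (c l) = d l" if "l \<in> {1..n}" for l
    using permutes_inverses(2)[OF \<sigma>, of l] that cd(1)[OF that] by (simp add: f_def \<sigma>_def)
  have "h = wreath_to_Aut G n (f, \<sigma>)"
  proof (rule Aut_std_eqI[OF h wreath_to_Aut_closed[OF w]])
    fix x assume "x \<in> ?S"
    then show "h x = wreath_to_Aut G n (f, \<sigma>) x"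
      by (cases x) (simp add: h_eq wreath_to_Aut_apply f_eq \<sigma>_def)
  qed
  with w show ?thesis by blast
qed

lemma (in group) wreath_to_Aut_iso: "wreath_to_Aut G n \<in> iso (wreath G n) (Aut_std G n)"
  unfolding iso_def hom_def bij_betw_def
  using wreath_to_Aut_closed wreath_to_Aut_mult wreath_to_Aut_inj wreath_to_Aut_surj by blast

text \<open>The group axioms are transported along the inverse of \<open>wreath_to_Aut\<close>, so that no direct
  calculation with the twisted multiplication is needed.\<close>

lemma (in group) group_wreath: "group (wreath G n)"
proof -
  let ?W = "wreath G n" and ?A = "Aut_std G n"
  let ?j = "inv_into (carrier ?W) (wreath_to_Aut G n)"
  have bij: "bij_betw (wreath_to_Aut G n) (carrier ?W) (carrier ?A)"
    using wreath_to_Aut_iso by (simp add: iso_def)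
  have one_in: "\<one>\<^bsub>?W\<^esub> \<in> carrier ?W"
    by (simp add: wreath_def sym_group_def)
  have "wreath_to_Aut G n \<one>\<^bsub>?W\<^esub> = \<one>\<^bsub>?A\<^esub>"
    by (auto simp: wreath_def wreath_to_Aut_def sym_group_def Aut_std_def BijGroup_def fun_eq_iff)
  then have one: "?j \<one>\<^bsub>?A\<^esub> = \<one>\<^bsub>?W\<^esub>"
    using bij one_in by (metis bij_betw_inv_into_left)
  have "?j \<in> hom ?A ?W"
  proof (rule homI)
    fix x y assume xy: "x \<in> carrier ?A" "y \<in> carrier ?A"
    have j: "?j x \<in> carrier ?W" "?j y \<in> carrier ?W"
      using xy bij_betwE[OF bij_betw_inv_into[OF bij]] by blast+
    then show "?j x \<in> carrier ?W" by blast
    have "x \<otimes>\<^bsub>?A\<^esub> y = wreath_to_Aut G n (?j x \<otimes>\<^bsub>?W\<^esub> ?j y)"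
      using j xy bij by (simp add: wreath_to_Aut_mult bij_betw_inv_into_right)
    then show "?j (x \<otimes>\<^bsub>?A\<^esub> y) = ?j x \<otimes>\<^bsub>?W\<^esub> ?j y"
      using bij wreath_mult_closed[OF j] by (simp add: bij_betw_inv_into_left)
  qed
  from group.hom_imp_img_group[OF group_Aut_std this] show ?thesis
    using bij_betw_inv_into[OF bij] by (simp add: one bij_betw_def)
qed

section \<open>Conjugate homomorphisms\<close>

text \<open>Conjugacy as an intertwining condition. This form is free of inverses, and it is the one that
  becomes equivariance when the group elements act as maps.\<close>

lemma (in group) conj_rel_iff:
  "(\<theta>, \<theta>') \<in> conj_rel \<Gamma> G \<longleftrightarrow>
    \<theta> \<in> Homs \<Gamma> G \<and> \<theta>' \<in> Homs \<Gamma> G \<and>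
    (\<exists>w\<in>carrier G. \<forall>\<gamma>\<in>carrier \<Gamma>. \<theta>' \<gamma> \<otimes> w = w \<otimes> \<theta> \<gamma>)"
proof -
  have "\<theta>' \<gamma> = w \<otimes> \<theta> \<gamma> \<otimes> inv w \<longleftrightarrow> \<theta>' \<gamma> \<otimes> w = w \<otimes> \<theta> \<gamma>"
    if "\<theta> \<in> Homs \<Gamma> G" "\<theta>' \<in> Homs \<Gamma> G" "w \<in> carrier G" "\<gamma> \<in> carrier \<Gamma>" for w \<gamma>
  proof -
    have "\<theta> \<gamma> \<in> carrier G" "\<theta>' \<gamma> \<in> carrier G" using that by (auto simp: Homs_def hom_in_carrier)
    with that(3) show ?thesis by (metis inv_solve_right m_closed)
  qed
  then show ?thesis unfolding conj_rel_def by auto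
qed

lemma (in group) equiv_conj_rel: "equiv (Homs \<Gamma> G) (conj_rel \<Gamma> G)"
proof (rule equivI)
  have cl: "\<theta> \<gamma> \<in> carrier G" if "\<theta> \<in> Homs \<Gamma> G" "\<gamma> \<in> carrier \<Gamma>" for \<theta> \<gamma>
    using that by (auto simp: Homs_def hom_in_carrier)
  show "conj_rel \<Gamma> G \<subseteq> Homs \<Gamma> G \<times> Homs \<Gamma> G" by (auto simp: conj_rel_def)
  show "refl_on (Homs \<Gamma> G) (conj_rel \<Gamma> G)"
    by (rule refl_onI) (auto simp: conj_rel_iff cl intro!: bexI[of _ \<one>])
  show "sym (conj_rel \<Gamma> G)"
  proof (rule symI)
    fix \<theta> \<theta>' assume "(\<theta>, \<theta>') \<in> conj_rel \<Gamma> G"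
    then obtain w where H: "\<theta> \<in> Homs \<Gamma> G" "\<theta>' \<in> Homs \<Gamma> G" and w: "w \<in> carrier G"
      and eq: "\<And>\<gamma>. \<gamma> \<in> carrier \<Gamma> \<Longrightarrow> \<theta>' \<gamma> \<otimes> w = w \<otimes> \<theta> \<gamma>"
      by (auto simp: conj_rel_iff)
    have "\<theta> \<gamma> \<otimes> inv w = inv w \<otimes> \<theta>' \<gamma>" if "\<gamma> \<in> carrier \<Gamma>" for \<gamma>
      using eq[OF that] cl[OF H(1) that] cl[OF H(2) that] w
      by (metis inv_closed inv_solve_left inv_solve_right m_assoc m_closed)
    then show "(\<theta>', \<theta>) \<in> conj_rel \<Gamma> G"
      using H w by (auto simp: conj_rel_iff intro!: bexI[of _ "inv w"])
  qed
  show "trans (conj_rel \<Gamma> G)"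
  proof (rule transI)
    fix \<theta> \<theta>' \<theta>''
    assume "(\<theta>, \<theta>') \<in> conj_rel \<Gamma> G" "(\<theta>', \<theta>'') \<in> conj_rel \<Gamma> G"
    then obtain w w' where H: "\<theta> \<in> Homs \<Gamma> G" "\<theta>' \<in> Homs \<Gamma> G" "\<theta>'' \<in> Homs \<Gamma> G"
      and w: "w \<in> carrier G" "w' \<in> carrier G"
      and eq: "\<And>\<gamma>. \<gamma> \<in> carrier \<Gamma> \<Longrightarrow> \<theta>' \<gamma> \<otimes> w = w \<otimes> \<theta> \<gamma>"
        "\<And>\<gamma>. \<gamma> \<in> carrier \<Gamma> \<Longrightarrow> \<theta>'' \<gamma> \<otimes> w' = w' \<otimes> \<theta>' \<gamma>"
      by (auto simp: conj_rel_iff)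
    have "\<theta>'' \<gamma> \<otimes> (w' \<otimes> w) = (w' \<otimes> w) \<otimes> \<theta> \<gamma>" if "\<gamma> \<in> carrier \<Gamma>" for \<gamma>
      using eq[OF that] cl[OF H(1) that] cl[OF H(2) that] cl[OF H(3) that] w
      by (metis m_assoc)
    then show "(\<theta>, \<theta>'') \<in> conj_rel \<Gamma> G"
      using H w by (auto simp: conj_rel_iff intro!: bexI[of _ "w' \<otimes> w"])
  qed
qed

section \<open>Isomorphism of bundles\<close>

lemma bundle_iso_refl: "bundle_iso G \<Gamma> B B"
  unfolding bundle_iso_def by (rule exI[of _ id]) auto

lemma equivariant_bundle_closed:
  assumes "equivariant_bundle G \<Gamma> B" "p \<in> tot_space B"
  shows "g \<in> carrier G \<Longrightarrow> ract B p g \<in> tot_space B"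
    and "\<gamma> \<in> carrier \<Gamma> \<Longrightarrow> tact B \<gamma> p \<in> tot_space B"
  using assms group_action.element_image[of \<Gamma> "tot_space B" "tact B" \<gamma> p]
  by (auto simp: equivariant_bundle_def free_right_action_def)

lemma bundle_iso_sym:
  assumes B: "equivariant_bundle G \<Gamma> B" and iso: "bundle_iso G \<Gamma> B B'"
  shows "bundle_iso G \<Gamma> B' B"
proof -
  obtain F where F: "bij_betw F (tot_space B) (tot_space B')"
    and ract: "\<And>p g. p \<in> tot_space B \<Longrightarrow> g \<in> carrier G \<Longrightarrow> F (ract B p g) = ract B' (F p) g"
    and tact: "\<And>\<gamma> p. \<gamma> \<in> carrier \<Gamma> \<Longrightarrow> p \<in> tot_space B \<Longrightarrow> F (tact B \<gamma> p) = tact B' \<gamma> (F p)"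
    using iso by (auto simp: bundle_iso_def)
  let ?i = "inv_into (tot_space B) F"
  have i: "?i q \<in> tot_space B" "F (?i q) = q" if "q \<in> tot_space B'" for q
    using that F bij_betwE[OF bij_betw_inv_into[OF F]] by (auto simp: bij_betw_inv_into_right)
  have "?i (ract B' q g) = ract B (?i q) g" if "q \<in> tot_space B'" "g \<in> carrier G" for q g
    using ract[OF i(1)[OF that(1)] that(2)] i[OF that(1)] that F equivariant_bundle_closed(1)[OF B]
    by (metis bij_betw_inv_into_left)
  moreover have "?i (tact B' \<gamma> q) = tact B \<gamma> (?i q)" if "q \<in> tot_space B'" "\<gamma> \<in> carrier \<Gamma>" for q \<gamma>
    using tact[OF that(2) i(1)[OF that(1)]] i[OF that(1)] that F equivariant_bundle_closed(2)[OF B]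
    by (metis bij_betw_inv_into_left)
  ultimately show ?thesis
    unfolding bundle_iso_def using bij_betw_inv_into[OF F] by blast
qed

lemma bundle_iso_trans:
  assumes "bundle_iso G \<Gamma> B B'" "bundle_iso G \<Gamma> B' B''"
  shows "bundle_iso G \<Gamma> B B''"
proof -
  obtain F where F: "bij_betw F (tot_space B) (tot_space B')"
    "\<forall>p\<in>tot_space B. \<forall>g\<in>carrier G. F (ract B p g) = ract B' (F p) g"
    "\<forall>\<gamma>\<in>carrier \<Gamma>. \<forall>p\<in>tot_space B. F (tact B \<gamma> p) = tact B' \<gamma> (F p)"
    using assms(1) unfolding bundle_iso_def by blast
  obtain F' where F': "bij_betw F' (tot_space B') (tot_space B'')"
    "\<forall>p\<in>tot_space B'. \<forall>g\<in>carrier G. F' (ract B' p g) = ract B'' (F' p) g"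
    "\<forall>\<gamma>\<in>carrier \<Gamma>. \<forall>p\<in>tot_space B'. F' (tact B' \<gamma> p) = tact B'' \<gamma> (F' p)"
    using assms(2) unfolding bundle_iso_def by blast
  have "F p \<in> tot_space B'" if "p \<in> tot_space B" for p
    using bij_betwE[OF F(1)] that by blast
  then show ?thesis
    unfolding bundle_iso_def
    using bij_betw_trans[OF F(1) F'(1)] F F'
    by (intro exI[of _ "F' \<circ> F"]) simp
qed

lemma equiv_bundle_iso_rel:
  "equiv {B. bundle_of_order G \<Gamma> n B} (bundle_iso_rel G \<Gamma> n)"
  by (intro equivI refl_onI symI transI)
    (auto simp: bundle_iso_rel_def bundle_of_order_def bundle_iso_refl
      intro: bundle_iso_sym bundle_iso_trans)

lemma bundle_iso_rel_Image:
  "bundle_of_order G \<Gamma> n B \<Longrightarrow> bundle_iso_rel G \<Gamma> n `` {B} = bundle_class G \<Gamma> n B"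
  by (auto simp: bundle_iso_rel_def bundle_class_def)

text \<open>The two bundles may live over different types, so this also identifies the class of an arbitrary
  bundle with the class of any of its isomorphic copies.\<close>

lemma bundle_class_eq:
  assumes "bundle_of_order G \<Gamma> n B" and "bundle_iso G \<Gamma> B B'"
  shows "bundle_class G \<Gamma> n B = bundle_class G \<Gamma> n B'"
proof -
  have "bundle_iso G \<Gamma> B' B"
    using assms bundle_iso_sym by (auto simp: bundle_of_order_def)
  then show ?thesis
    using assms(2) by (auto simp: bundle_class_def intro: bundle_iso_trans)
qed


section \<open>The bundle of a homomorphism\<close>

text \<open>The trivial bundle with \<open>\<Gamma>\<close> acting through \<open>\<theta>\<close>. The permutation is restricted in \<open>bact\<close> because
  group actions are normalised outside the set acted upon, whereas elements of the symmetric group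
  are the identity there.\<close>

definition model_bundle ::
  "('g, 'm) monoid_scheme \<Rightarrow> nat \<Rightarrow> ('c \<Rightarrow> (nat \<Rightarrow> 'g) \<times> (nat \<Rightarrow> nat)) \<Rightarrow> ('g, 'c) std_bundle" where
  "model_bundle G n \<theta> =
     \<lparr>tot_space = std_total G n, base = {1..n}, proj = fst, ract = std_ract G,
      tact = (\<lambda>\<gamma>. wreath_to_Aut G n (\<theta> \<gamma>)), bact = (\<lambda>\<gamma>. restrict (snd (\<theta> \<gamma>)) {1..n})\<rparr>"

lemma (in group) free_right_action_std: "free_right_action G (std_total G n) (std_ract G)"
  by (auto simp: free_right_action_def std_total_def m_assoc)

lemma (in group) group_hom_BijGroup_std:
  assumes "group \<Gamma>" "\<theta> \<in> hom \<Gamma> (wreath G n)"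
  shows "group_hom \<Gamma> (BijGroup (std_total G n)) (\<lambda>\<gamma>. wreath_to_Aut G n (\<theta> \<gamma>))"
proof -
  have "(\<lambda>\<gamma>. wreath_to_Aut G n (\<theta> \<gamma>)) \<in> hom \<Gamma> (Aut_std G n)"
    using Group.hom_compose[OF assms(2), of "wreath_to_Aut G n" "Aut_std G n"] wreath_to_Aut_iso
    by (simp add: iso_def comp_def)
  then have "(\<lambda>\<gamma>. wreath_to_Aut G n (\<theta> \<gamma>)) \<in> hom \<Gamma> (BijGroup (std_total G n))"
    by (auto simp: hom_def Aut_std_def BijGroup_def)
  then show ?thesis
    using assms(1) group_BijGroup by (simp add: group_hom_def group_hom_axioms_def)
qed

lemma (in group) snd_wreath_hom:
  assumes "group \<Gamma>" "\<theta> \<in> hom \<Gamma> (wreath G n)"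
  shows "group_hom \<Gamma> (BijGroup {1..n}) (\<lambda>\<gamma>. restrict (snd (\<theta> \<gamma>)) {1..n})"
proof -
  have perm: "snd (\<theta> \<gamma>) permutes {1..n}" if "\<gamma> \<in> carrier \<Gamma>" for \<gamma>
    using hom_in_carrier[OF assms(2) that] by (cases "\<theta> \<gamma>") (simp add: mem_wreath)
  have comp: "snd (\<theta> (\<gamma> \<otimes>\<^bsub>\<Gamma>\<^esub> \<delta>)) = snd (\<theta> \<gamma>) \<circ> snd (\<theta> \<delta>)"
    if "\<gamma> \<in> carrier \<Gamma>" "\<delta> \<in> carrier \<Gamma>" for \<gamma> \<delta>
    using perm[OF that(1)] hom_mult[OF assms(2) that]
    by (cases "\<theta> \<gamma>"; cases "\<theta> \<delta>") (simp add: mult_wreath)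
  have bij: "restrict (snd (\<theta> \<gamma>)) {1..n} \<in> Bij {1..n}" if "\<gamma> \<in> carrier \<Gamma>" for \<gamma>
    using permutes_imp_bij[OF perm[OF that]] by (simp add: Bij_def)
  have "(\<lambda>\<gamma>. restrict (snd (\<theta> \<gamma>)) {1..n}) \<in> hom \<Gamma> (BijGroup {1..n})"
  proof (rule homI)
    fix \<gamma> \<delta> assume "\<gamma> \<in> carrier \<Gamma>" "\<delta> \<in> carrier \<Gamma>"
    then show "restrict (snd (\<theta> (\<gamma> \<otimes>\<^bsub>\<Gamma>\<^esub> \<delta>))) {1..n} =
        restrict (snd (\<theta> \<gamma>)) {1..n} \<otimes>\<^bsub>BijGroup {1..n}\<^esub> restrict (snd (\<theta> \<delta>)) {1..n}"
      using permutes_in_image[OF perm]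
      by (auto simp: BijGroup_def bij comp compose_def fun_eq_iff simp del: atLeastAtMost_iff)
  qed (simp add: BijGroup_def bij)
  then show ?thesis
    using assms(1) group_BijGroup by (simp add: group_hom_def group_hom_axioms_def)
qed

lemma (in group) bundle_of_order_model:
  assumes "group \<Gamma>" "\<theta> \<in> Homs \<Gamma> (wreath G n)"
  shows "bundle_of_order G \<Gamma> n (model_bundle G n \<theta>)"
proof -
  have \<theta>: "\<theta> \<in> hom \<Gamma> (wreath G n)" using assms(2) by (simp add: Homs_def)
  have aut: "wreath_to_Aut G n (\<theta> \<gamma>) \<in> carrier (Aut_std G n)" if "\<gamma> \<in> carrier \<Gamma>" for \<gamma>
    using hom_in_carrier[OF \<theta> that] by (rule wreath_to_Aut_closed)
  have "\<exists>p\<in>std_total G n. {q \<in> std_total G n. fst q = z} = std_ract G p ` carrier G"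
    if "z \<in> {1..n}" for z
    using that by (intro bexI[of _ "(z, \<one>)"]) (auto simp: image_iff)
  moreover have "fst (wreath_to_Aut G n (\<theta> \<gamma>) x) = restrict (snd (\<theta> \<gamma>)) {1..n} (fst x)"
    if "\<gamma> \<in> carrier \<Gamma>" "x \<in> std_total G n" for \<gamma> x
    using that by (cases x; cases "\<theta> \<gamma>") (simp add: wreath_to_Aut_apply)
  moreover have "wreath_to_Aut G n (\<theta> \<gamma>) (std_ract G x g) = std_ract G (wreath_to_Aut G n (\<theta> \<gamma>) x) g"
    if "\<gamma> \<in> carrier \<Gamma>" "x \<in> std_total G n" "g \<in> carrier G" for \<gamma> x g
    using aut[OF that(1)] that by (simp add: mem_Aut_std)
  moreover have "fst \<in> std_total G n \<rightarrow> {1..n}" by (auto simp: std_total_def)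
  ultimately show ?thesis
    using group_hom_BijGroup_std[OF assms(1) \<theta>] snd_wreath_hom[OF assms(1) \<theta>]
    by (simp add: bundle_of_order_def equivariant_bundle_def model_bundle_def
        free_right_action_std group_action_def)
qed

text \<open>Both sides ask for a \<open>w\<close> in the wreath product that intertwines \<open>\<theta>\<close> and \<open>\<theta>'\<close>: an isomorphism
  restricts to an automorphism of the trivial bundle, which comes from a unique \<open>w\<close>; and since
  \<open>wreath_to_Aut\<close> is faithful, intertwining can be tested on points.\<close>

lemma (in group) model_iso_iff_conj:
  assumes \<theta>: "\<theta> \<in> Homs \<Gamma> (wreath G n)" and \<theta>': "\<theta>' \<in> Homs \<Gamma> (wreath G n)"
  shows "bundle_iso G \<Gamma> (model_bundle G n \<theta>) (model_bundle G n \<theta>') \<longleftrightarrow>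
    (\<theta>, \<theta>') \<in> conj_rel \<Gamma> (wreath G n)"
proof -
  let ?S = "std_total G n" and ?W = "wreath G n" and ?\<Psi> = "wreath_to_Aut G n"
  have cl: "\<theta> \<gamma> \<in> carrier ?W" "\<theta>' \<gamma> \<in> carrier ?W" if "\<gamma> \<in> carrier \<Gamma>" for \<gamma>
    using that \<theta> \<theta>' by (auto simp: Homs_def hom_in_carrier)
  have \<Psi>_apply: "?\<Psi> (u \<otimes>\<^bsub>?W\<^esub> v) x = ?\<Psi> u (?\<Psi> v x)"
    if "u \<in> carrier ?W" "v \<in> carrier ?W" "x \<in> ?S" for u v x
    using that by (simp add: wreath_to_Aut_mult mult_Aut_std wreath_to_Aut_closed compose_eq)
  have commute: "\<theta>' \<gamma> \<otimes>\<^bsub>?W\<^esub> w = w \<otimes>\<^bsub>?W\<^esub> \<theta> \<gamma> \<longleftrightarrow>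
      (\<forall>x\<in>?S. ?\<Psi> w (?\<Psi> (\<theta> \<gamma>) x) = ?\<Psi> (\<theta>' \<gamma>) (?\<Psi> w x))"
    if w: "w \<in> carrier ?W" and \<gamma>: "\<gamma> \<in> carrier \<Gamma>" for w \<gamma>
  proof
    assume "\<theta>' \<gamma> \<otimes>\<^bsub>?W\<^esub> w = w \<otimes>\<^bsub>?W\<^esub> \<theta> \<gamma>"
    then show "\<forall>x\<in>?S. ?\<Psi> w (?\<Psi> (\<theta> \<gamma>) x) = ?\<Psi> (\<theta>' \<gamma>) (?\<Psi> w x)"
      using w cl[OF \<gamma>] \<Psi>_apply by metis
  next
    assume "\<forall>x\<in>?S. ?\<Psi> w (?\<Psi> (\<theta> \<gamma>) x) = ?\<Psi> (\<theta>' \<gamma>) (?\<Psi> w x)"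
    then have "?\<Psi> (\<theta>' \<gamma> \<otimes>\<^bsub>?W\<^esub> w) = ?\<Psi> (w \<otimes>\<^bsub>?W\<^esub> \<theta> \<gamma>)"
      using w cl[OF \<gamma>]
      by (intro Aut_std_eqI[of _ G n] wreath_to_Aut_closed wreath_mult_closed) (simp_all add: \<Psi>_apply)
    then show "\<theta>' \<gamma> \<otimes>\<^bsub>?W\<^esub> w = w \<otimes>\<^bsub>?W\<^esub> \<theta> \<gamma>"
      using w cl[OF \<gamma>] by (auto dest!: inj_onD[OF wreath_to_Aut_inj] simp: wreath_mult_closed)
  qed
  show ?thesis
  proof
    assume "bundle_iso G \<Gamma> (model_bundle G n \<theta>) (model_bundle G n \<theta>')"
    then obtain F where F: "bij_betw F ?S ?S"
      "\<And>x g. x \<in> ?S \<Longrightarrow> g \<in> carrier G \<Longrightarrow> F (std_ract G x g) = std_ract G (F x) g"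
      "\<And>\<gamma> x. \<gamma> \<in> carrier \<Gamma> \<Longrightarrow> x \<in> ?S \<Longrightarrow> F (?\<Psi> (\<theta> \<gamma>) x) = ?\<Psi> (\<theta>' \<gamma>) (F x)"
      unfolding bundle_iso_def model_bundle_def gbundle.simps by blast
    have "restrict F ?S \<in> carrier (Aut_std G n)"
      using F(1,2) by (simp add: mem_Aut_std std_ract_closed)
    then obtain w where w: "w \<in> carrier ?W" "?\<Psi> w = restrict F ?S"
      using wreath_to_Aut_surj by (metis (no_types, lifting) imageE)
    have "\<theta>' \<gamma> \<otimes>\<^bsub>?W\<^esub> w = w \<otimes>\<^bsub>?W\<^esub> \<theta> \<gamma>" if "\<gamma> \<in> carrier \<Gamma>" for \<gamma>
      using commute[OF w(1) that] F(3)[OF that] Aut_std_closed[OF wreath_to_Aut_closed[OF cl(1)[OF that]]]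
      by (simp add: w(2))
    then show "(\<theta>, \<theta>') \<in> conj_rel \<Gamma> ?W"
      using \<theta> \<theta>' w(1) by (auto simp: group.conj_rel_iff[OF group_wreath])
  next
    assume "(\<theta>, \<theta>') \<in> conj_rel \<Gamma> ?W"
    then obtain w where w: "w \<in> carrier ?W"
      "\<And>\<gamma>. \<gamma> \<in> carrier \<Gamma> \<Longrightarrow> \<theta>' \<gamma> \<otimes>\<^bsub>?W\<^esub> w = w \<otimes>\<^bsub>?W\<^esub> \<theta> \<gamma>"
      by (auto simp: group.conj_rel_iff[OF group_wreath])
    then show "bundle_iso G \<Gamma> (model_bundle G n \<theta>) (model_bundle G n \<theta>')"
      using wreath_to_Aut_closed[OF w(1)] commute
      unfolding bundle_iso_def model_bundle_def mem_Aut_std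
      by (intro exI[of _ "?\<Psi> w"]) simp
  qed
qed


section \<open>Framings and trivializations\<close>

lemma equivariant_bundle_fibre:
  assumes "equivariant_bundle G \<Gamma> B" "z \<in> base B"
  shows "\<exists>p\<in>tot_space B. {q \<in> tot_space B. proj B q = z} = ract B p ` carrier G"
  using assms by (simp add: equivariant_bundle_def)

text \<open>The definition of a bundle provides one point in each fibre whose orbit is the fibre; since orbits
  are the same from each of their points, any point will do.\<close>

lemma (in group) fibre_eq_orbit:
  assumes B: "equivariant_bundle G \<Gamma> B" and p: "p \<in> tot_space B"
  shows "{q \<in> tot_space B. proj B q = proj B p} = ract B p ` carrier G"
proof -
  have assoc: "ract B q (g \<otimes> h) = ract B (ract B q g) h"
    if "q \<in> tot_space B" "g \<in> carrier G" "h \<in> carrier G" for q g h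
    using B that by (simp add: equivariant_bundle_def free_right_action_def)
  have "proj B p \<in> base B" using B p by (auto simp: equivariant_bundle_def)
  then obtain p0 where p0: "p0 \<in> tot_space B"
    and fib: "{q \<in> tot_space B. proj B q = proj B p} = ract B p0 ` carrier G"
    using equivariant_bundle_fibre[OF B] by blast
  from fib p obtain a where a: "a \<in> carrier G" "p = ract B p0 a" by blast
  have "ract B p0 ` carrier G = ract B p ` carrier G"
  proof (intro equalityI image_subsetI)
    fix g assume g: "g \<in> carrier G"
    show "ract B p g \<in> ract B p0 ` carrier G"
      using assoc[OF p0 a(1) g] a g by (intro image_eqI[of _ _ "a \<otimes> g"]) simp_all
    have "ract B p0 g = ract B p (inv a \<otimes> g)"
      using assoc[OF p0 a(1), of "inv a \<otimes> g"] a g by (simp add: m_assoc[symmetric])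
    then show "ract B p0 g \<in> ract B p ` carrier G" using a g by auto
  qed
  with fib show ?thesis by simp
qed

lemma (in group) framing_exists:
  assumes "bundle_of_order G \<Gamma> n B"
  shows "\<exists>t s. framing n B t s"
proof -
  have B: "equivariant_bundle G \<Gamma> B" and fin: "finite (base B)" "card (base B) = n"
    using assms by (auto simp: bundle_of_order_def)
  obtain t where "bij_betw t {1..n} (base B)"
    using ex_bij_betw_nat_finite_1[OF fin(1)] fin(2) by blast
  moreover have "\<forall>z\<in>base B. \<exists>p. p \<in> tot_space B \<and> proj B p = z"
  proof
    fix z assume "z \<in> base B"
    then obtain p0 where p0: "p0 \<in> tot_space B"
      and fib: "{q \<in> tot_space B. proj B q = z} = ract B p0 ` carrier G"
      using equivariant_bundle_fibre[OF B] by blast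
    have "ract B p0 \<one> = p0"
      using B p0 by (simp add: equivariant_bundle_def free_right_action_def)
    then have "p0 \<in> {q \<in> tot_space B. proj B q = z}"
      unfolding fib by (intro image_eqI[of _ _ \<one>]) simp_all
    then show "\<exists>p. p \<in> tot_space B \<and> proj B p = z" by blast
  qed
  then obtain s where "\<forall>z\<in>base B. s z \<in> tot_space B \<and> proj B (s z) = z"
    by metis
  ultimately show ?thesis by (auto simp: framing_def)
qed

text \<open>Bijectivity splits into the base and the fibres: \<open>t\<close> is bijective on base points, and on the
  fibre over \<open>t l\<close> the map \<open>g \<mapsto> s (t l) \<cdot> g\<close> is surjective because the fibre is a single orbit and
  injective because the action is free.\<close>

lemma (in group) trivialization_properties:
  assumes B: "equivariant_bundle G \<Gamma> B" and fr: "framing n B t s"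
  shows trivialization_bij: "bij_betw (trivialization B t s) (std_total G n) (tot_space B)"
    and proj_trivialization: "x \<in> std_total G n \<Longrightarrow> proj B (trivialization B t s x) = t (fst x)"
    and trivialization_ract: "x \<in> std_total G n \<Longrightarrow> k \<in> carrier G \<Longrightarrow>
      trivialization B t s (std_ract G x k) = ract B (trivialization B t s x) k"
proof -
  let ?S = "std_total G n" and ?\<phi> = "trivialization B t s"
  have act: "\<And>p. p \<in> tot_space B \<Longrightarrow> ract B p \<one> = p"
    "\<And>p g h. p \<in> tot_space B \<Longrightarrow> g \<in> carrier G \<Longrightarrow> h \<in> carrier G \<Longrightarrow>
      ract B p (g \<otimes> h) = ract B (ract B p g) h"
    "\<And>p g. p \<in> tot_space B \<Longrightarrow> g \<in> carrier G \<Longrightarrow> ract B p g = p \<Longrightarrow> g = \<one>"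
    using B by (simp_all add: equivariant_bundle_def free_right_action_def)
  have t: "bij_betw t {1..n} (base B)" using fr by (simp add: framing_def)
  have st: "s (t l) \<in> tot_space B" "proj B (s (t l)) = t l" if "l \<in> {1..n}" for l
    using fr bij_betwE[OF t] that by (auto simp: framing_def)
  have closed: "?\<phi> x \<in> tot_space B" if "x \<in> ?S" for x
    using that st equivariant_bundle_closed(1)[OF B] by (cases x) (simp add: trivialization_def)
  have proj: "proj B (?\<phi> x) = t (fst x)" if "x \<in> ?S" for x
    using fibre_eq_orbit[OF B st(1)] st that by (cases x) (auto simp: trivialization_def)
  show "x \<in> ?S \<Longrightarrow> proj B (?\<phi> x) = t (fst x)" by (rule proj)
  show "x \<in> ?S \<Longrightarrow> k \<in> carrier G \<Longrightarrow> ?\<phi> (std_ract G x k) = ract B (?\<phi> x) k"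
    using st act(2) by (cases x) (simp add: trivialization_def)
  have "inj_on ?\<phi> ?S"
  proof (rule inj_onI)
    fix x y assume xy: "x \<in> ?S" "y \<in> ?S" "?\<phi> x = ?\<phi> y"
    obtain l g k h where [simp]: "x = (l, g)" "y = (k, h)" by (cases x, cases y)
    have l: "l \<in> {1..n}" and g: "g \<in> carrier G" "h \<in> carrier G" using xy by simp_all
    have "t l = t k" using proj xy by (metis \<open>x = (l, g)\<close> \<open>y = (k, h)\<close> fst_conv)
    then have [simp]: "k = l" using t xy by (auto simp: bij_betw_def dest: inj_onD)
    have eq: "ract B (s (t l)) g = ract B (s (t l)) h" using xy(3) by (simp add: trivialization_def)
    have "ract B (s (t l)) (g \<otimes> inv h) = ract B (s (t l)) (h \<otimes> inv h)"
      unfolding act(2)[OF st(1)[OF l] g(1) inv_closed[OF g(2)]]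
        act(2)[OF st(1)[OF l] g(2) inv_closed[OF g(2)]] eq ..
    then have "g \<otimes> inv h = \<one>" using act(1,3) st(1)[OF l] g by simp
    then show "x = y" using g by (simp add: inv_solve_right')
  qed
  moreover have "q \<in> ?\<phi> ` ?S" if q: "q \<in> tot_space B" for q
  proof -
    have "proj B q \<in> base B" using B q by (auto simp: equivariant_bundle_def)
    then obtain l where l: "l \<in> {1..n}" "t l = proj B q" using bij_betw_imp_surj_on[OF t] by (metis imageE)
    have "q \<in> {q \<in> tot_space B. proj B q = proj B (s (t l))}"
      using st(2)[OF l(1)] l(2) q by simp
    then have "q \<in> ract B (s (t l)) ` carrier G"
      unfolding fibre_eq_orbit[OF B st(1)[OF l(1)]] .
    then obtain g where "g \<in> carrier G" "q = ract B (s (t l)) g" by blast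
    then show ?thesis using l by (intro image_eqI[of _ _ "(l, g)"]) (simp_all add: trivialization_def)
  qed
  ultimately show "bij_betw ?\<phi> ?S (tot_space B)" using closed by (auto simp: bij_betw_def)
qed

text \<open>The transported action is characterised by making the trivialization equivariant. As
  the trivialization is injective, identities between transported maps can be checked in \<open>B\<close>.\<close>

lemma (in group) transported_action_spec:
  assumes B: "equivariant_bundle G \<Gamma> B" and fr: "framing n B t s"
    and \<gamma>: "\<gamma> \<in> carrier \<Gamma>" and x: "x \<in> std_total G n"
  shows transported_action_closed: "transported_action G n B t s \<gamma> x \<in> std_total G n"
    and trivialization_transported_action:
      "trivialization B t s (transported_action G n B t s \<gamma> x) = tact B \<gamma> (trivialization B t s x)"
proof -
  let ?\<phi> = "trivialization B t s"
  have \<phi>: "bij_betw ?\<phi> (std_total G n) (tot_space B)" by (rule trivialization_bij[OF B fr])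
  have "tact B \<gamma> (?\<phi> x) \<in> tot_space B"
    using equivariant_bundle_closed(2)[OF B _ \<gamma>] bij_betwE[OF \<phi>] x by blast
  then show "transported_action G n B t s \<gamma> x \<in> std_total G n"
    "?\<phi> (transported_action G n B t s \<gamma> x) = tact B \<gamma> (?\<phi> x)"
    using x \<phi> bij_betwE[OF bij_betw_inv_into[OF \<phi>]]
    by (auto simp: transported_action_def bij_betw_inv_into_right)
qed

lemma (in group) transported_action_hom:
  assumes B: "equivariant_bundle G \<Gamma> B" and fr: "framing n B t s"
  shows "transported_action G n B t s \<in> hom \<Gamma> (Aut_std G n)"
proof -
  let ?S = "std_total G n" and ?\<phi> = "trivialization B t s" and ?h = "transported_action G n B t s"
  note spec = transported_action_spec[OF B fr]
  have \<phi>: "bij_betw ?\<phi> ?S (tot_space B)" by (rule trivialization_bij[OF B fr])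
  have \<phi>_in: "?\<phi> x \<in> tot_space B" if "x \<in> ?S" for x using bij_betwE[OF \<phi>] that by blast
  have \<phi>_inj: "x = y" if "?\<phi> x = ?\<phi> y" "x \<in> ?S" "y \<in> ?S" for x y
    using \<phi> that by (auto simp: bij_betw_def dest: inj_onD)
  have act: "group_action \<Gamma> (tot_space B) (tact B)" using B by (simp add: equivariant_bundle_def)
  then interpret \<Gamma>: group \<Gamma> by (auto simp: group_action_def group_hom_def)
  have aut: "?h \<gamma> \<in> carrier (Aut_std G n)" if \<gamma>: "\<gamma> \<in> carrier \<Gamma>" for \<gamma>
  proof -
    have "bij_betw (tact B \<gamma>) (tot_space B) (tot_space B)"
      using group_action.bij_prop0[OF act \<gamma>] by (simp add: Bij_def)
    then have "bij_betw (inv_into ?S ?\<phi> \<circ> (tact B \<gamma> \<circ> ?\<phi>)) ?S ?S"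
      using \<phi> by (blast intro: bij_betw_trans bij_betw_inv_into)
    then have "bij_betw (?h \<gamma>) ?S ?S"
      by (simp add: transported_action_def comp_def)
    moreover have "?h \<gamma> (std_ract G x k) = std_ract G (?h \<gamma> x) k" if x: "x \<in> ?S" and k: "k \<in> carrier G" for x k
    proof (rule \<phi>_inj)
      have "?\<phi> (?h \<gamma> (std_ract G x k)) = tact B \<gamma> (ract B (?\<phi> x) k)"
        using spec(2)[OF \<gamma>] trivialization_ract[OF B fr] x k by (simp add: std_ract_closed)
      also have "\<dots> = ract B (tact B \<gamma> (?\<phi> x)) k"
        using B \<gamma> \<phi>_in[OF x] k by (simp add: equivariant_bundle_def)
      also have "\<dots> = ?\<phi> (std_ract G (?h \<gamma> x) k)"
        using spec[OF \<gamma>] trivialization_ract[OF B fr] x k by simp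
      finally show "?\<phi> (?h \<gamma> (std_ract G x k)) = ?\<phi> (std_ract G (?h \<gamma> x) k)" .
    qed (use spec(1)[OF \<gamma>] x k in \<open>simp_all add: std_ract_closed\<close>)
    ultimately show ?thesis by (simp add: mem_Aut_std transported_action_def)
  qed
  show ?thesis
  proof (rule homI)
    fix \<gamma> \<delta> assume \<gamma>: "\<gamma> \<in> carrier \<Gamma>" and \<delta>: "\<delta> \<in> carrier \<Gamma>"
    have "?h (\<gamma> \<otimes>\<^bsub>\<Gamma>\<^esub> \<delta>) x = ?h \<gamma> (?h \<delta> x)" if x: "x \<in> ?S" for x
      using spec[OF \<gamma>] spec[OF \<delta>] spec[of "\<gamma> \<otimes>\<^bsub>\<Gamma>\<^esub> \<delta>"] \<gamma> \<delta> x
        group_action.composition_rule[OF act \<phi>_in[OF x] \<gamma> \<delta>]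
      by (intro \<phi>_inj) simp_all
    then show "?h (\<gamma> \<otimes>\<^bsub>\<Gamma>\<^esub> \<delta>) = ?h \<gamma> \<otimes>\<^bsub>Aut_std G n\<^esub> ?h \<delta>"
      using aut \<gamma> \<delta> monoid.m_closed[OF group.is_monoid[OF group_Aut_std] aut[OF \<gamma>] aut[OF \<delta>]]
      by (intro Aut_std_eqI[of _ G n]) (simp_all add: mult_Aut_std compose_eq)
  qed (rule aut)
qed

lemma (in group) bundle_hom_spec:
  assumes B: "equivariant_bundle G \<Gamma> B" and fr: "framing n B t s"
  shows bundle_hom_in_Homs: "bundle_hom G \<Gamma> n B t s \<in> Homs \<Gamma> (wreath G n)"
    and wreath_to_Aut_bundle_hom: "\<gamma> \<in> carrier \<Gamma> \<Longrightarrow>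
      wreath_to_Aut G n (bundle_hom G \<Gamma> n B t s \<gamma>) = transported_action G n B t s \<gamma>"
proof -
  let ?W = "wreath G n" and ?\<Psi> = "wreath_to_Aut G n"
  let ?h = "transported_action G n B t s" and ?j = "inv_into (carrier ?W) ?\<Psi>"
  have h: "?h \<in> hom \<Gamma> (Aut_std G n)" by (rule transported_action_hom[OF B fr])
  have "?j \<in> hom (Aut_std G n) ?W"
    using group.iso_set_sym[OF group_wreath wreath_to_Aut_iso] by (simp add: iso_def)
  from Group.hom_compose[OF h this] have j: "(\<lambda>\<gamma>. ?j (?h \<gamma>)) \<in> hom \<Gamma> ?W" by (simp add: comp_def)
  have "group \<Gamma>" using B by (auto simp: equivariant_bundle_def group_action_def group_hom_def)
  then interpret \<Gamma>: group \<Gamma> .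
  show "bundle_hom G \<Gamma> n B t s \<in> Homs \<Gamma> ?W"
    using j by (auto simp: Homs_def bundle_hom_def hom_def Pi_iff)
  show "\<gamma> \<in> carrier \<Gamma> \<Longrightarrow> ?\<Psi> (bundle_hom G \<Gamma> n B t s \<gamma>) = ?h \<gamma>"
    using wreath_to_Aut_surj[OF hom_in_carrier[OF h]] by (simp add: bundle_hom_def f_inv_into_f)
qed

text \<open>The trivialization itself is the isomorphism: it is \<open>\<Gamma>\<close>-equivariant because \<open>bundle_hom\<close> is the
  action transported along it.\<close>

lemma (in group) model_bundle_hom_iso:
  assumes B: "equivariant_bundle G \<Gamma> B" and fr: "framing n B t s"
  shows "bundle_iso G \<Gamma> (model_bundle G n (bundle_hom G \<Gamma> n B t s)) B"
  unfolding bundle_iso_def model_bundle_def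
  using trivialization_bij[OF B fr] trivialization_ract[OF B fr]
    trivialization_transported_action[OF B fr]
  by (intro exI[of _ "trivialization B t s"]) (simp add: wreath_to_Aut_bundle_hom[OF B fr])


section \<open>The correspondence\<close>

text \<open>Each bundle is replaced by the model of its homomorphism. Taking \<open>B' = B\<close> shows that changing the
  framing only conjugates the homomorphism.\<close>

lemma (in group) bundle_iso_iff_conj:
  assumes B: "equivariant_bundle G \<Gamma> B" and fr: "framing n B t s"
    and B': "equivariant_bundle G \<Gamma> B'" and fr': "framing n B' t' s'"
  shows "bundle_iso G \<Gamma> B B' \<longleftrightarrow>
    (bundle_hom G \<Gamma> n B t s, bundle_hom G \<Gamma> n B' t' s') \<in> conj_rel \<Gamma> (wreath G n)"
proof -
  let ?\<theta> = "bundle_hom G \<Gamma> n B t s" and ?\<theta>' = "bundle_hom G \<Gamma> n B' t' s'"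
  have \<Gamma>: "group \<Gamma>" using B by (auto simp: equivariant_bundle_def group_action_def group_hom_def)
  note hom = bundle_hom_in_Homs[OF B fr] bundle_hom_in_Homs[OF B' fr']
  note iso = model_bundle_hom_iso[OF B fr] model_bundle_hom_iso[OF B' fr']
  have eq: "equivariant_bundle G \<Gamma> (model_bundle G n ?\<theta>)" "equivariant_bundle G \<Gamma> (model_bundle G n ?\<theta>')"
    using bundle_of_order_model[OF \<Gamma>] hom by (auto simp: bundle_of_order_def)
  have "bundle_iso G \<Gamma> B B' \<longleftrightarrow> bundle_iso G \<Gamma> (model_bundle G n ?\<theta>) (model_bundle G n ?\<theta>')"
    using iso bundle_iso_sym[OF eq(1) iso(1)] bundle_iso_sym[OF eq(2) iso(2)]
    by (blast intro: bundle_iso_trans)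
  then show ?thesis by (simp add: model_iso_iff_conj[OF hom])
qed

text \<open>The model of a bundle is an isomorphic copy of it within the types used to form the isomorphism
  classes, which makes the class nonempty.\<close>

lemma (in group) bundle_class_in_classes:
  assumes B: "bundle_of_order G \<Gamma> n B"
  shows "bundle_class G \<Gamma> n B \<in> bundle_classes G \<Gamma> n"
proof -
  have B': "equivariant_bundle G \<Gamma> B" using B by (simp add: bundle_of_order_def)
  then have \<Gamma>: "group \<Gamma>" by (auto simp: equivariant_bundle_def group_action_def group_hom_def)
  obtain t s where fr: "framing n B t s" using framing_exists[OF B] by blast
  let ?M = "model_bundle G n (bundle_hom G \<Gamma> n B t s)"
  have M: "bundle_of_order G \<Gamma> n ?M"
    using bundle_of_order_model[OF \<Gamma> bundle_hom_in_Homs[OF B' fr]] .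
  have "bundle_class G \<Gamma> n B = bundle_iso_rel G \<Gamma> n `` {?M}"
    using bundle_class_eq[OF M model_bundle_hom_iso[OF B' fr]] bundle_iso_rel_Image[OF M] by simp
  then show ?thesis using M by (simp add: bundle_classes_def quotientI)
qed

text \<open>All conjugacy classes in the union defining the correspondence coincide, and the union is not
  empty.\<close>

lemma (in group) bundle_correspondence_class:
  assumes B: "bundle_of_order G \<Gamma> n B" and fr: "framing n B t s"
  shows "bundle_correspondence G \<Gamma> n (bundle_class G \<Gamma> n B) =
    conj_rel \<Gamma> (wreath G n) `` {bundle_hom G \<Gamma> n B t s}"
proof -
  let ?R = "conj_rel \<Gamma> (wreath G n)" and ?C = "bundle_class G \<Gamma> n B"
  have B': "equivariant_bundle G \<Gamma> B" using B by (simp add: bundle_of_order_def)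
  have eq: "?R `` {bundle_hom G \<Gamma> n D t' s'} = ?R `` {bundle_hom G \<Gamma> n B t s}"
    if D: "D \<in> ?C" and fr': "framing n D t' s'" for D t' s'
  proof -
    have "equivariant_bundle G \<Gamma> D" "bundle_iso G \<Gamma> B D"
      using D by (auto simp: bundle_class_def bundle_of_order_def)
    then have "(bundle_hom G \<Gamma> n B t s, bundle_hom G \<Gamma> n D t' s') \<in> ?R"
      using bundle_iso_iff_conj[OF B' fr _ fr'] by blast
    then show ?thesis using equiv_class_eq[OF group.equiv_conj_rel[OF group_wreath]] by metis
  qed
  have "?C \<noteq> {}"
    using bundle_class_in_classes[OF B] equiv_bundle_iso_rel in_quotient_imp_non_empty
    unfolding bundle_classes_def by metis
  then obtain D where D: "D \<in> ?C" by blast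
  then obtain t' s' where "framing n D t' s'"
    using framing_exists[of \<Gamma> n D] by (auto simp: bundle_class_def)
  with D eq show ?thesis unfolding bundle_correspondence_def by blast
qed

lemma (in group) bundle_correspondence_bij:
  fixes \<Gamma> :: "('c, 'k) monoid_scheme"
  assumes \<Gamma>: "group \<Gamma>"
  shows "bij_betw (bundle_correspondence G \<Gamma> n) (bundle_classes G \<Gamma> n)
    (Homs \<Gamma> (wreath G n) // conj_rel \<Gamma> (wreath G n))"
proof -
  let ?W = "wreath G n" and ?R = "conj_rel \<Gamma> (wreath G n)" and ?b = "bundle_correspondence G \<Gamma> n"
  note equiv = group.equiv_conj_rel[OF group_wreath, of \<Gamma> n]
  have rep: "\<exists>(B :: ('a, 'c) std_bundle) t s.
      C = bundle_class G \<Gamma> n B \<and> bundle_of_order G \<Gamma> n B \<and> framing n B t s"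
    if "C \<in> bundle_classes G \<Gamma> n" for C
  proof -
    obtain B where B: "C = bundle_iso_rel G \<Gamma> n `` {B}" "bundle_of_order G \<Gamma> n B"
      using \<open>C \<in> bundle_classes G \<Gamma> n\<close> by (auto simp: bundle_classes_def elim: quotientE)
    then show ?thesis
      using bundle_iso_rel_Image[OF B(2)] framing_exists[OF B(2)] by blast
  qed
  have "inj_on ?b (bundle_classes G \<Gamma> n)"
  proof (rule inj_onI)
    fix C D assume CD: "C \<in> bundle_classes G \<Gamma> n" "D \<in> bundle_classes G \<Gamma> n" "?b C = ?b D"
    obtain B :: "('a, 'c) std_bundle" and t s
      where B: "C = bundle_class G \<Gamma> n B" "bundle_of_order G \<Gamma> n B" "framing n B t s"
      using rep[OF CD(1)] by blast
    obtain B' :: "('a, 'c) std_bundle" and t' s'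
      where B': "D = bundle_class G \<Gamma> n B'" "bundle_of_order G \<Gamma> n B'" "framing n B' t' s'"
      using rep[OF CD(2)] by blast
    have eqv: "equivariant_bundle G \<Gamma> B" "equivariant_bundle G \<Gamma> B'"
      using B(2) B'(2) by (simp_all add: bundle_of_order_def)
    have "?R `` {bundle_hom G \<Gamma> n B t s} = ?R `` {bundle_hom G \<Gamma> n B' t' s'}"
      using CD(3) B B' by (simp add: bundle_correspondence_class)
    then have "(bundle_hom G \<Gamma> n B t s, bundle_hom G \<Gamma> n B' t' s') \<in> ?R"
      using eq_equiv_class[OF _ equiv] bundle_hom_in_Homs[OF eqv(2) B'(3)] by blast
    then have "bundle_iso G \<Gamma> B B'"
      using bundle_iso_iff_conj[OF eqv(1) B(3) eqv(2) B'(3)] by blast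
    then show "C = D" using B(1) B'(1) bundle_class_eq[OF B(2)] by simp
  qed
  moreover have "?b C \<in> Homs \<Gamma> ?W // ?R" if "C \<in> bundle_classes G \<Gamma> n" for C
  proof -
    obtain B :: "('a, 'c) std_bundle" and t s
      where B: "C = bundle_class G \<Gamma> n B" "bundle_of_order G \<Gamma> n B" "framing n B t s"
      using rep[OF \<open>C \<in> bundle_classes G \<Gamma> n\<close>] by blast
    then have "bundle_hom G \<Gamma> n B t s \<in> Homs \<Gamma> ?W"
      by (auto simp: bundle_of_order_def intro: bundle_hom_in_Homs)
    then show ?thesis using B by (simp add: bundle_correspondence_class quotientI)
  qed
  moreover have "K \<in> ?b ` bundle_classes G \<Gamma> n" if K: "K \<in> Homs \<Gamma> ?W // ?R" for K
  proof -
    obtain \<theta> where \<theta>: "\<theta> \<in> Homs \<Gamma> ?W" "K = ?R `` {\<theta>}" using K by (auto elim: quotientE)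
    let ?M = "model_bundle G n \<theta>"
    have M: "bundle_of_order G \<Gamma> n ?M" by (rule bundle_of_order_model[OF \<Gamma> \<theta>(1)])
    then have eqv: "equivariant_bundle G \<Gamma> ?M" by (simp add: bundle_of_order_def)
    obtain t s where fr: "framing n ?M t s" using framing_exists[OF M] by blast
    \<comment> \<open>The homomorphism of an arbitrary framing of the model need not be \<open>\<theta>\<close>, but its model is
      isomorphic to that of \<open>\<theta>\<close>.\<close>
    have "(bundle_hom G \<Gamma> n ?M t s, \<theta>) \<in> ?R"
      using model_bundle_hom_iso[OF eqv fr] model_iso_iff_conj[OF bundle_hom_in_Homs[OF eqv fr] \<theta>(1)]
      by blast
    then have "?b (bundle_class G \<Gamma> n ?M) = K"
      unfolding bundle_correspondence_class[OF M fr] \<theta>(2) by (rule equiv_class_eq[OF equiv])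
    then show ?thesis using bundle_class_in_classes[OF M] by blast
  qed
  ultimately show ?thesis unfolding bij_betw_def by blast
qed

theorem theoremD:
  fixes G :: "('g, 'm) monoid_scheme"
    and \<Gamma> :: "('c, 'k) monoid_scheme"
    and n :: nat
  assumes "group G" and "group \<Gamma>" and "n \<ge> 1"
  shows "wreath_to_Aut G n \<in> iso (wreath G n) (Aut_std G n) \<and>
         bij_betw (bundle_correspondence G \<Gamma> n)
           (bundle_classes G \<Gamma> n)
           (Homs \<Gamma> (wreath G n) // conj_rel \<Gamma> (wreath G n)) \<and>
         (\<forall>B :: ('g, 'c, 'p, 'z) gbundle. bundle_of_order G \<Gamma> n B \<longrightarrow>
            bundle_class G \<Gamma> n B \<in> bundle_classes G \<Gamma> n \<and>
            (\<exists>t s. framing n B t s) \<and>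
            (\<forall>t s. framing n B t s \<longrightarrow>
               bij_betw (trivialization B t s) (std_total G n) (tot_space B) \<and>
               (\<forall>x\<in>std_total G n. proj B (trivialization B t s x) = t (fst x)) \<and>
               (\<forall>x\<in>std_total G n. \<forall>k\<in>carrier G.
                  trivialization B t s (std_ract G x k) = ract B (trivialization B t s x) k) \<and>
               transported_action G n B t s \<in> hom \<Gamma> (Aut_std G n) \<and>
               bundle_hom G \<Gamma> n B t s \<in> Homs \<Gamma> (wreath G n) \<and>
               (\<forall>\<gamma>\<in>carrier \<Gamma>. wreath_to_Aut G n (bundle_hom G \<Gamma> n B t s \<gamma>) =
                  transported_action G n B t s \<gamma>) \<and>
               bundle_correspondence G \<Gamma> n (bundle_class G \<Gamma> n B) =
                 conj_rel \<Gamma> (wreath G n) `` {bundle_hom G \<Gamma> n B t s}))"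
proof -
  interpret group G by fact
  show ?thesis
  proof (intro conjI allI impI ballI)
    show "wreath_to_Aut G n \<in> iso (wreath G n) (Aut_std G n)"
      by (rule wreath_to_Aut_iso)
    show "bij_betw (bundle_correspondence G \<Gamma> n) (bundle_classes G \<Gamma> n)
        (Homs \<Gamma> (wreath G n) // conj_rel \<Gamma> (wreath G n))"
      by (rule bundle_correspondence_bij[OF \<open>group \<Gamma>\<close>])
  next
    fix B :: "('g, 'c, 'p, 'z) gbundle"
    assume B: "bundle_of_order G \<Gamma> n B"
    then have B': "equivariant_bundle G \<Gamma> B" by (simp add: bundle_of_order_def)
    show "bundle_class G \<Gamma> n B \<in> bundle_classes G \<Gamma> n" by (rule bundle_class_in_classes[OF B])
    show "\<exists>t s. framing n B t s" by (rule framing_exists[OF B])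
    fix t s assume fr: "framing n B t s"
    show "bij_betw (trivialization B t s) (std_total G n) (tot_space B)"
      by (rule trivialization_bij[OF B' fr])
    show "transported_action G n B t s \<in> hom \<Gamma> (Aut_std G n)"
      by (rule transported_action_hom[OF B' fr])
    show "bundle_hom G \<Gamma> n B t s \<in> Homs \<Gamma> (wreath G n)"
      by (rule bundle_hom_in_Homs[OF B' fr])
    show "bundle_correspondence G \<Gamma> n (bundle_class G \<Gamma> n B) =
        conj_rel \<Gamma> (wreath G n) `` {bundle_hom G \<Gamma> n B t s}"
      by (rule bundle_correspondence_class[OF B fr])
    show "wreath_to_Aut G n (bundle_hom G \<Gamma> n B t s \<gamma>) = transported_action G n B t s \<gamma>"
      if "\<gamma> \<in> carrier \<Gamma>" for \<gamma>
      using that by (rule wreath_to_Aut_bundle_hom[OF B' fr])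
    fix x assume x: "x \<in> std_total G n"
    show "proj B (trivialization B t s x) = t (fst x)"
      using x by (rule proj_trivialization[OF B' fr])
    show "trivialization B t s (std_ract G x k) = ract B (trivialization B t s x) k"
      if "k \<in> carrier G" for k
      using x that by (rule trivialization_ract[OF B' fr])
  qed
qed

end
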